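(* Let $Z$ be a discrete topological space of cardinality $\aleph_1$. Then $\mathrm{BMet}(Z)$ is not a Borel subset of $\mathrm{CPM}(Z)$.
   Context: For a topological space $X$, a continuous pseudometric on $X$ is a continuous map $d\colon X\times X\to[0,\infty)$ such that $d(x,x)=0$, $d(x,y)=d(y,x)$ and $d(x,z)\le d(x,y)+d(y,z)$ for all $x,y,z\in X$. $\mathrm{CPM}(X)$ denotes the set of all continuous pseudometrics on $X$, equipped with the topology induced by the supremum metric $\mathcal{D}_X(d,e)=\sup_{(x,y)\in X^2}|d(x,y)-e(x,y)|\in[0,\infty]$ (equivalently, by the metric $\min\{\mathcal{D}_X,1\}$). For a metrizable space $X$, $\mathrm{Met}(X)\subseteq \mathrm{CPM}(X)$ is the set of all metrics on $X$ that induce the topology of $X$, and $\mathrm{BMet}(X)\subseteq\mathrm{Met}(X)$ is the subset of bounded ones. *)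

theory Defs
  imports "HOL-Analysis.Analysis"
begin

unbundle cardinal_syntax

(* A map on X \<times> X is encoded by a total curried function that is 0 off
   topspace X \<times> topspace X. Thus equality in CPM X is equality of pseudometrics, and the
   unrelativised nonnegativity and symmetry axioms of Metric_space hold automatically. *)
definition CPM :: "'a topology \<Rightarrow> ('a \<Rightarrow> 'a \<Rightarrow> real) set" where
  "CPM X = {d.
     continuous_map (prod_topology X X) (top_of_set {0..}) (\<lambda>(x, y). d x y) \<and>
     (\<forall>x\<in>topspace X. d x x = 0) \<and>
     (\<forall>x\<in>topspace X. \<forall>y\<in>topspace X. d x y = d y x) \<and>
     (\<forall>x\<in>topspace X. \<forall>y\<in>topspace X. \<forall>z\<in>topspace X. d x z \<le> d x y + d y z) \<and>
     (\<forall>x y. x \<notin> topspace X \<or> y \<notin> topspace X \<longrightarrow> d x y = 0)}"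

definition sup_dist :: "'a topology \<Rightarrow> ('a \<Rightarrow> 'a \<Rightarrow> real) \<Rightarrow> ('a \<Rightarrow> 'a \<Rightarrow> real) \<Rightarrow> ennreal" where
  "sup_dist X d e = (SUP (x, y)\<in>topspace X \<times> topspace X. ennreal \<bar>d x y - e x y\<bar>)"

(* The truncation makes the metric real-valued; the lemma openin_CPM_topology below shows that
   this is the topology of the extended metric sup_dist. *)
definition CPM_dist :: "'a topology \<Rightarrow> ('a \<Rightarrow> 'a \<Rightarrow> real) \<Rightarrow> ('a \<Rightarrow> 'a \<Rightarrow> real) \<Rightarrow> real" where
  "CPM_dist X d e = enn2real (min (sup_dist X d e) 1)"

definition CPM_topology :: "'a topology \<Rightarrow> ('a \<Rightarrow> 'a \<Rightarrow> real) topology" where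
  "CPM_topology X = Metric_space.mtopology (CPM X) (CPM_dist X)"

definition Met :: "'a topology \<Rightarrow> ('a \<Rightarrow> 'a \<Rightarrow> real) set" where
  "Met X = {d \<in> CPM X. Metric_space (topspace X) d \<and> Metric_space.mtopology (topspace X) d = X}"

definition BMet :: "'a topology \<Rightarrow> ('a \<Rightarrow> 'a \<Rightarrow> real) set" where
  "BMet X = {d \<in> Met X. \<exists>B. \<forall>x\<in>topspace X. \<forall>y\<in>topspace X. d x y \<le> B}"

definition borel_sets_of :: "'a topology \<Rightarrow> 'a set set" where
  "borel_sets_of T = sigma_sets (topspace T) {U. openin T U}"

lemma sup_dist_commute: "sup_dist X d e = sup_dist X e d"
  by (simp add: sup_dist_def abs_minus_commute)

lemma sup_dist_triangle: "sup_dist X d f \<le> sup_dist X d e + sup_dist X e f"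
  unfolding sup_dist_def
proof (rule SUP_least, clarify)
  fix x y assume xy: "x \<in> topspace X" "y \<in> topspace X"
  have "ennreal \<bar>d x y - f x y\<bar> \<le> ennreal (\<bar>d x y - e x y\<bar> + \<bar>e x y - f x y\<bar>)"
    by (rule ennreal_leI) linarith
  also have "\<dots> = ennreal \<bar>d x y - e x y\<bar> + ennreal \<bar>e x y - f x y\<bar>"
    by simp
  also have "\<dots> \<le> (SUP (x, y)\<in>topspace X \<times> topspace X. ennreal \<bar>d x y - e x y\<bar>) +
      (SUP (x, y)\<in>topspace X \<times> topspace X. ennreal \<bar>e x y - f x y\<bar>)"
    using xy by (intro add_mono SUP_upper2[where i = "(x, y)"]) auto
  finally show "ennreal \<bar>d x y - f x y\<bar> \<le> \<dots>" .
qed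

lemma sup_dist_eq_0_iff:
  assumes "d \<in> CPM X" "e \<in> CPM X"
  shows "sup_dist X d e = 0 \<longleftrightarrow> d = e"
proof
  assume "sup_dist X d e = 0"
  then have *: "d x y = e x y" if "x \<in> topspace X" "y \<in> topspace X" for x y
    using that unfolding sup_dist_def by (auto simp: bot_ennreal[symmetric] SUP_bot_conv simp del: bot_ennreal) (auto simp: bot_ennreal)
  show "d = e"
    using * assms unfolding CPM_def by (intro ext) (smt (verit) mem_Collect_eq)
next
  assume "d = e" then show "sup_dist X d e = 0"
    by (simp add: sup_dist_def bot_ennreal[symmetric] case_prod_beta del: bot_ennreal)
qed

lemma ennreal_CPM_dist: "ennreal (CPM_dist X d e) = min (sup_dist X d e) 1"
proof -
  have "min (sup_dist X d e) 1 < top"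
    by (simp add: min_less_iff_disj)
  then show ?thesis by (simp add: CPM_dist_def)
qed

lemma Metric_space_CPM: "Metric_space (CPM X) (CPM_dist X)"
proof
  show "0 \<le> CPM_dist X d e" for d e by (simp add: CPM_dist_def)
  then have nn: "CPM_dist X d e \<ge> 0" for d e .
  show "CPM_dist X d e = CPM_dist X e d" for d e by (simp add: CPM_dist_def sup_dist_commute)
  show "CPM_dist X d e = 0 \<longleftrightarrow> d = e" if "d \<in> CPM X" "e \<in> CPM X" for d e
  proof -
    have "CPM_dist X d e = 0 \<longleftrightarrow> ennreal (CPM_dist X d e) = 0"
      using nn[of d e] by (simp add: ennreal_eq_0_iff)
    also have "\<dots> \<longleftrightarrow> sup_dist X d e = 0"
      unfolding ennreal_CPM_dist by (auto simp: min_def)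
    finally show ?thesis using sup_dist_eq_0_iff[OF that] by simp
  qed
  show "CPM_dist X d f \<le> CPM_dist X d e + CPM_dist X e f" for d e f
  proof -
    have "min (sup_dist X d f) 1 \<le> min (sup_dist X d e) 1 + min (sup_dist X e f) 1"
      using sup_dist_triangle[of X d f e]
      by (auto simp: min_def intro: order_trans add_increasing add_increasing2)
    then have "ennreal (CPM_dist X d f) \<le> ennreal (CPM_dist X d e + CPM_dist X e f)"
      using nn by (simp add: ennreal_CPM_dist)
    then show ?thesis using nn by (subst (asm) ennreal_le_iff) (auto intro: add_nonneg_nonneg)
  qed
qed

lemma topspace_CPM_topology [simp]: "topspace (CPM_topology X) = CPM X"
  by (simp add: CPM_topology_def Metric_space.topspace_mtopology Metric_space_CPM)

lemma openin_CPM_topology: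
  "openin (CPM_topology X) U \<longleftrightarrow>
     U \<subseteq> CPM X \<and> (\<forall>d\<in>U. \<exists>\<epsilon>>0. \<forall>e\<in>CPM X. sup_dist X d e < ennreal \<epsilon> \<longrightarrow> e \<in> U)"
proof -
  interpret Metric_space "CPM X" "CPM_dist X" by (rule Metric_space_CPM)
  have lt: "CPM_dist X d e < r \<longleftrightarrow> sup_dist X d e < ennreal r" if "0 < r" "r \<le> 1" for d e r
  proof -
    have "CPM_dist X d e < r \<longleftrightarrow> ennreal (CPM_dist X d e) < ennreal r"
      using that by (simp add: ennreal_less_iff)
    also have "\<dots> \<longleftrightarrow> sup_dist X d e < ennreal r"
      using that by (auto simp: ennreal_CPM_dist min_less_iff_disj)
    finally show ?thesis .
  qed
  have "(\<exists>r>0. mball d r \<subseteq> U) \<longleftrightarrow> (\<exists>\<epsilon>>0. \<forall>e\<in>CPM X. sup_dist X d e < ennreal \<epsilon> \<longrightarrow> e \<in> U)"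
    if "d \<in> CPM X" for d
  proof
    assume "\<exists>r>0. mball d r \<subseteq> U"
    then obtain r where r: "r > 0" "mball d r \<subseteq> U" by blast
    have "e \<in> U" if "e \<in> CPM X" "sup_dist X d e < ennreal (min r 1)" for e
    proof -
      have "CPM_dist X d e < min r 1" using lt[of "min r 1"] r that by simp
      then show ?thesis using r that \<open>d \<in> CPM X\<close> by (auto simp: in_mball)
    qed
    then show "\<exists>\<epsilon>>0. \<forall>e\<in>CPM X. sup_dist X d e < ennreal \<epsilon> \<longrightarrow> e \<in> U"
      using r by (intro exI[of _ "min r 1"]) auto
  next
    assume "\<exists>\<epsilon>>0. \<forall>e\<in>CPM X. sup_dist X d e < ennreal \<epsilon> \<longrightarrow> e \<in> U"
    then obtain r where r: "r > 0" "\<And>e. e \<in> CPM X \<Longrightarrow> sup_dist X d e < ennreal r \<Longrightarrow> e \<in> U"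
      by blast
    have "mball d (min r 1) \<subseteq> U"
    proof
      fix e assume "e \<in> mball d (min r 1)"
      then have "e \<in> CPM X" "sup_dist X d e < ennreal (min r 1)"
        using lt[of "min r 1" d e] r by (auto simp: in_mball)
      moreover have "ennreal (min r 1) \<le> ennreal r" by (rule ennreal_leI) simp
      ultimately show "e \<in> U" using r by (meson order_less_le_trans)
    qed
    then show "\<exists>r>0. mball d r \<subseteq> U" using r by (intro exI[of _ "min r 1"]) auto
  qed
  then show ?thesis
    unfolding CPM_topology_def openin_mtopology by (meson subsetD)
qed

end

theory Submission
  imports Defs
begin

text \<open>Let \<open>h\<close> map \<open>Z\<close> onto a subset \<open>X\<close> of a metric space such that all fibres of \<open>h\<close> have at least
  two points. The pseudometrics \<open>d\<^sub>x\<close> with \<open>d\<^sub>x z z' = max (g z) (g z')\<close> for \<open>z \<noteq> z'\<close>, where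
  \<open>g z = min 1 (dist x (h z))\<close>, depend continuously on \<open>x\<close>, and \<open>d\<^sub>x\<close> lies in \<open>BMet Z\<close> iff
  \<open>x \<notin> X\<close>: for \<open>x \<in> X\<close> two points of \<open>Z\<close> have distance \<open>0\<close>, and otherwise the ball of radius
  \<open>g z\<close> around \<open>z\<close> is \<open>{z}\<close>. It therefore suffices to find a non-Borel subset of a Polish space
  with at most \<open>\<aleph>\<^sub>1\<close> points. If the continuum is \<open>\<aleph>\<^sub>1\<close>, every non-Borel set will do; if it is larger,
  every set with \<open>\<aleph>\<^sub>1\<close> points will do, since an uncountable Borel (indeed analytic) set has the
  cardinality of the continuum.\<close>

section \<open>Cardinalities and a Cantor scheme\<close>

lemma ex_basis_sequence:
  "\<exists>b :: nat \<Rightarrow> 'a::second_countable_topology set. topological_basis (range b)"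
proof -
  obtain B :: "'a set set" where B: "countable B" "topological_basis B"
    using ex_countable_basis by blast
  have "B \<noteq> {}"
    using topological_basisE[OF B(2) open_UNIV UNIV_I] by blast
  then have "range (from_nat_into B) = B"
    using B(1) by (rule range_from_nat_into)
  then have "topological_basis (range (from_nat_into B))"
    using B(2) by simp
  then show ?thesis by (rule exI[of _ "from_nat_into B"])
qed

text \<open>In a T0 space a point is determined by which sets of a base contain it, and the base can
  be indexed by the naturals.\<close>

lemma card_of_second_countable_le:
  "|UNIV :: 'a::{second_countable_topology, t0_space} set| \<le>o |UNIV :: (nat \<Rightarrow> bool) set|"
proof -
  obtain b :: "nat \<Rightarrow> 'a set" where b: "topological_basis (range b)"
    using ex_basis_sequence by blast
  have "inj (\<lambda>x n. x \<in> b n)"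
  proof (rule injI, rule ccontr)
    fix x y assume eq: "(\<lambda>n. x \<in> b n) = (\<lambda>n. y \<in> b n)" and "x \<noteq> y"
    obtain U where U: "open U" "(x \<in> U) \<noteq> (y \<in> U)" using t0_space_class.t0_space[OF \<open>x \<noteq> y\<close>] by metis
    have same: "x \<in> C \<longleftrightarrow> y \<in> C" if "C \<in> range b" for C
      using that fun_cong[OF eq] by auto
    obtain z where z: "z \<in> U" "z \<in> {x, y}" using U(2) by auto
    obtain C where "C \<in> range b" "z \<in> C" "C \<subseteq> U"
      by (rule topological_basisE[OF b U(1) z(1)])
    then have "x \<in> U \<and> y \<in> U" using same[of C] z(2) by auto
    then show False using U(2) by simp
  qed
  then show ?thesis using card_of_ordLeq by blast
qed

text \<open>Perfect set argument: a binary tree of shrinking closed balls is built so that sibling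
  balls have disjoint images under \<open>p\<close>. Completeness gives each branch a point of
  \<open>F\<close>, and different branches get different images.\<close>

lemma inj_Cantor_into_image:
  fixes F :: "'a::{complete_space, second_countable_topology} set" and p :: "'a \<Rightarrow> 'b::t2_space"
  assumes F: "closed F" and p: "continuous_on UNIV p" and unc: "uncountable (p ` F)"
  obtains g :: "(nat \<Rightarrow> bool) \<Rightarrow> 'b" where "inj g" "range g \<subseteq> p ` F"
proof -
  obtain B :: "'a set set" where B: "countable B" "topological_basis B"
    using ex_countable_basis by blast
  \<comment> \<open>Condensation points relative to \<open>p\<close>. Discarding
    \<open>F - P\<close> costs only countably many image values, since countably many basic sets
    cover it.\<close>
  define P where "P = {x \<in> F. \<forall>U. open U \<longrightarrow> x \<in> U \<longrightarrow> uncountable (p ` (F \<inter> U))}"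
  have "p ` (F - P) \<subseteq> (\<Union>C\<in>{C \<in> B. countable (p ` (F \<inter> C))}. p ` (F \<inter> C))"
  proof clarify
    fix x assume x: "x \<in> F" "x \<notin> P"
    then obtain U where U: "open U" "x \<in> U" "countable (p ` (F \<inter> U))"
      unfolding P_def by blast
    obtain C where C: "C \<in> B" "x \<in> C" "C \<subseteq> U"
      using topological_basisE[OF B(2) U(1,2)] by blast
    have "countable (p ` (F \<inter> C))"
      by (rule countable_subset[OF _ U(3)]) (use C in blast)
    then show "p x \<in> (\<Union>C\<in>{C \<in> B. countable (p ` (F \<inter> C))}. p ` (F \<inter> C))"
      using C x by blast
  qed
  moreover have "countable (\<Union>C\<in>{C \<in> B. countable (p ` (F \<inter> C))}. p ` (F \<inter> C))"
    using B(1) by (intro countable_UN) auto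
  ultimately have small: "countable (p ` (F - P))"
    by (rule countable_subset)
  \<comment> \<open>Both points are found in \<open>P\<close> again, so that the splitting can be
    iterated.\<close>
  have two: "\<exists>a b. a \<in> P \<inter> U \<and> b \<in> P \<inter> U \<and> p a \<noteq> p b"
    if "uncountable (p ` (F \<inter> U))" for U
  proof (rule ccontr)
    assume contra: "\<not> ?thesis"
    have "countable (p ` (P \<inter> U))"
    proof (cases "P \<inter> U = {}")
      case False
      then obtain a where "a \<in> P \<inter> U" by blast
      then have "p b = p a" if "b \<in> P \<inter> U" for b using contra that by metis
      then have "p ` (P \<inter> U) \<subseteq> {p a}" by auto
      then show ?thesis by (rule countable_subset) simp
    qed simp
    moreover have "p ` (F \<inter> U) \<subseteq> p ` (P \<inter> U) \<union> p ` (F - P)" by blast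
    ultimately show False using that small by (meson countable_Un countable_subset)
  qed
  \<comment> \<open>The ball with centre and radius \<open>(x, r)\<close> splits into two smaller
    ones. Halving the radii makes the diameters along a branch tend to 0.\<close>
  define Q where "Q = (\<lambda>(x, r) ((a, s), (b, t)).
    a \<in> P \<and> b \<in> P \<and> 0 < s \<and> 0 < t \<and> s \<le> r / 2 \<and> t \<le> r / 2 \<and>
    cball a s \<subseteq> cball x r \<and> cball b t \<subseteq> cball x r \<and>
    p ` cball a s \<inter> p ` cball b t = {})"
  have split: "\<exists>w. Q (x, r) w" if "x \<in> P" "0 < r" for x and r :: real
  proof -
    have "uncountable (p ` (F \<inter> ball x r))"
      using that unfolding P_def by auto
    then obtain a b where ab: "a \<in> P" "b \<in> P" "a \<in> ball x r" "b \<in> ball x r" "p a \<noteq> p b"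
      using two[of "ball x r"] by auto
    obtain V W where VW: "open V" "open W" "p a \<in> V" "p b \<in> W" "V \<inter> W = {}"
      using hausdorff[OF ab(5)] by blast
    have "open (p -` V \<inter> ball x r)" "open (p -` W \<inter> ball x r)"
      using p VW by (auto intro!: open_Int open_vimage)
    moreover have "a \<in> p -` V \<inter> ball x r" "b \<in> p -` W \<inter> ball x r"
      using ab VW by auto
    ultimately obtain s' t' where st': "0 < s'" "cball a s' \<subseteq> p -` V \<inter> ball x r"
        "0 < t'" "cball b t' \<subseteq> p -` W \<inter> ball x r"
      unfolding open_contains_cball by metis
    define s t where "s = min s' (r / 2)" and "t = min t' (r / 2)"
    have st: "0 < s" "0 < t" "s \<le> r / 2" "t \<le> r / 2"
      using st' \<open>0 < r\<close> by (simp_all add: s_def t_def)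
    have sub: "cball a s \<subseteq> p -` V \<inter> ball x r" "cball b t \<subseteq> p -` W \<inter> ball x r"
      using st'(2,4) by (auto simp: s_def t_def)
    then have "cball a s \<subseteq> cball x r" "cball b t \<subseteq> cball x r"
      using ball_subset_cball[of x r] by auto
    moreover have "p ` cball a s \<subseteq> V" "p ` cball b t \<subseteq> W"
      using sub by (simp_all add: image_subset_iff_subset_vimage)
    then have "p ` cball a s \<inter> p ` cball b t = {}"
      using VW(5) by blast
    ultimately have "Q (x, r) ((a, s), (b, t))"
      using ab st by (simp add: Q_def)
    then show ?thesis ..
  qed
  define q where "q = (\<lambda>w. SOME v. Q w v)"
  have q: "Q w (q w)" if "fst w \<in> P" "0 < snd w" for w
    unfolding q_def using someI_ex[OF split[OF that]] by simp
  obtain x0 where x0: "x0 \<in> P" using two[of UNIV] unc by auto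
  \<comment> \<open>\<open>S \<beta> n\<close> is the node reached after \<open>n\<close> steps,
    where \<open>\<beta>\<close> chooses the first or second child; \<open>K \<beta> n\<close> is
    its ball.\<close>
  define S where "S = (\<lambda>\<beta> :: nat \<Rightarrow> bool.
    rec_nat (x0, 1 :: real) (\<lambda>n w. (if \<beta> n then fst else snd) (q w)))"
  define K where "K = (\<lambda>\<beta> n. cball (fst (S \<beta> n)) (snd (S \<beta> n)))"
  have S0: "S \<beta> 0 = (x0, 1)" and SS: "S \<beta> (Suc n) = (if \<beta> n then fst else snd) (q (S \<beta> n))" for \<beta> n
    by (simp_all add: S_def)
  have S: "fst (S \<beta> n) \<in> P \<and> 0 < snd (S \<beta> n) \<and> snd (S \<beta> n) \<le> (1/2) ^ n" for \<beta> n
  proof (induction n)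
    case 0 then show ?case using x0 by (simp add: S0)
  next
    case (Suc n)
    then show ?case using q[of "S \<beta> n"] unfolding SS Q_def by (auto split: prod.splits)
  qed
  have K_Suc: "K \<beta> (Suc n) \<subseteq> K \<beta> n" for \<beta> n
    using q[of "S \<beta> n"] S[of \<beta> n] unfolding K_def SS Q_def by (auto split: prod.splits)
  have K_mono: "K \<beta> n \<subseteq> K \<beta> m" if "m \<le> n" for \<beta> m n
    using that K_Suc lift_Suc_antimono_le[of "K \<beta>"] by blast
  have K_split: "p ` K \<beta> (Suc n) \<inter> p ` K \<gamma> (Suc n) = {}" if "S \<beta> n = S \<gamma> n" "\<beta> n" "\<not> \<gamma> n" for \<beta> \<gamma> n
    using q[of "S \<beta> n"] S[of \<beta> n] that unfolding K_def SS Q_def by (auto split: prod.splits)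
  have "\<exists>a \<in> F. \<forall>n. a \<in> K \<beta> n" for \<beta>
  proof -
    \<comment> \<open>The centre of each ball lies in \<open>P\<close>, hence in
      \<open>F\<close>.\<close>
    have ne: "K \<beta> n \<inter> F \<noteq> {}" for n
      using S[of \<beta> n] unfolding K_def P_def by force
    have small: "\<exists>n. \<forall>x\<in>K \<beta> n \<inter> F. \<forall>y\<in>K \<beta> n \<inter> F. dist x y < \<epsilon>" if \<epsilon>: "0 < \<epsilon>" for \<epsilon>
    proof -
      obtain n where n: "(1/2 :: real) ^ n < \<epsilon> / 2"
        using real_arch_pow_inv[of "\<epsilon>/2" "1/2"] \<epsilon> by auto
      have "dist x y < \<epsilon>" if "x \<in> K \<beta> n" "y \<in> K \<beta> n" for x y
        using that S[of \<beta> n] n dist_triangle3[of x y "fst (S \<beta> n)"] unfolding K_def mem_cball by linarith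
      then show ?thesis by blast
    qed
    have closed: "closed (K \<beta> n \<inter> F)" for n
      using F by (simp add: K_def closed_Int)
    have mono: "K \<beta> n \<inter> F \<subseteq> K \<beta> m \<inter> F" if "m \<le> n" for m n
      using K_mono[OF that, of \<beta>] by blast
    have "\<exists>a. \<forall>n. a \<in> K \<beta> n \<inter> F"
      by (rule decreasing_closed_nest[of "\<lambda>n. K \<beta> n \<inter> F", OF closed ne mono small]) blast+
    then show ?thesis by blast
  qed
  then obtain a where a: "\<And>\<beta>. a \<beta> \<in> F" "\<And>\<beta> n. a \<beta> \<in> K \<beta> n" by metis
  have "inj (p \<circ> a)"
  proof (rule injI, rule ccontr)
    fix \<beta> \<gamma> assume eq: "(p \<circ> a) \<beta> = (p \<circ> a) \<gamma>" and "\<beta> \<noteq> \<gamma>"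
    \<comment> \<open>The branches share their nodes up to the first disagreement, where they enter
      sibling balls.\<close>
    define n where "n = (LEAST n. \<beta> n \<noteq> \<gamma> n)"
    have n: "\<beta> n \<noteq> \<gamma> n"
      using \<open>\<beta> \<noteq> \<gamma>\<close> LeastI_ex[of "\<lambda>n. \<beta> n \<noteq> \<gamma> n"] unfolding n_def by blast
    have "S \<beta> m = S \<gamma> m" if "m \<le> n" for m
      using that
    proof (induction m)
      case (Suc m)
      then have "\<beta> m = \<gamma> m" using not_less_Least[of m "\<lambda>n. \<beta> n \<noteq> \<gamma> n"] unfolding n_def by auto
      then show ?case using Suc by (simp add: SS)
    qed (simp add: S0)
    then have "S \<beta> n = S \<gamma> n" by simp
    then have "p ` K \<beta> (Suc n) \<inter> p ` K \<gamma> (Suc n) = {}"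
      using n K_split[of \<beta> n \<gamma>] K_split[of \<gamma> n \<beta>] by auto
    then show False using a eq by (metis comp_apply disjoint_iff imageI)
  qed
  moreover have "range (p \<circ> a) \<subseteq> p ` F" using a by auto
  ultimately show thesis by (rule that)
qed

section \<open>Analytic sets\<close>

text \<open>The Polish space \<open>nat \<Rightarrow> real\<close> serves as witness space in place
  of Baire space; a sequence can code countably many witnesses.\<close>

definition analytic_set :: "'a::topological_space set \<Rightarrow> bool" where
  "analytic_set A \<longleftrightarrow> (\<exists>F :: ('a \<times> (nat \<Rightarrow> real)) set. closed F \<and> A = fst ` F)"

lemma analytic_set_iff:
  "analytic_set A \<longleftrightarrow> (\<exists>F. closed F \<and> (\<forall>x. x \<in> A \<longleftrightarrow> (\<exists>f :: nat \<Rightarrow> real. (x, f) \<in> F)))"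
  unfolding analytic_set_def by (intro ex_cong1 conj_cong refl) force

lemma closed_imp_analytic_set: "closed A \<Longrightarrow> analytic_set A"
  unfolding analytic_set_def by (intro exI[of _ "A \<times> UNIV"]) (auto simp: closed_Times)

lemma analytic_set_UN:
  fixes A :: "nat \<Rightarrow> 'a::topological_space set"
  assumes "\<And>n. analytic_set (A n)"
  shows "analytic_set (\<Union>n. A n)"
proof -
  obtain F :: "nat \<Rightarrow> ('a \<times> (nat \<Rightarrow> real)) set" where
    F: "\<And>n. closed (F n)" "\<And>n x. x \<in> A n \<longleftrightarrow> (\<exists>f. (x, f) \<in> F n)"
    using assms unfolding analytic_set_iff by metis
  \<comment> \<open>Coordinate 0 of a witness names the index \<open>n\<close>, and the tail is a
    witness for \<open>F n\<close>. As coordinate 0 is a natural number, staying at distance at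
    least 1 from \<open>n\<close> means differing from \<open>n\<close>, and this condition is
    closed.\<close>
  define G where "G = (\<lambda>xf :: 'a \<times> (nat \<Rightarrow> real). snd xf 0) -` \<nat> \<inter>
    (\<Inter>n. {xf. 1 \<le> \<bar>snd xf 0 - real n\<bar>} \<union> (\<lambda>xf. (fst xf, \<lambda>k. snd xf (Suc k))) -` F n)"
  have coord: "continuous_on UNIV (\<lambda>xf :: 'a \<times> (nat \<Rightarrow> real). snd xf k)" for k
    by (rule continuous_on_compose2[OF continuous_on_product_coordinates]) (auto intro: continuous_intros)
  have "closed (\<nat> :: real set)"
    unfolding Nats_def by (rule closed_of_nat_image)
  then have "closed G"
    unfolding G_def
    by (intro closed_Int closed_INT ballI closed_Un closed_vimage closed_Collect_le F
        continuous_intros continuous_on_coordinatewise_then_product coord)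
  moreover have "x \<in> (\<Union>n. A n) \<longleftrightarrow> (\<exists>f. (x, f) \<in> G)" for x
  proof
    assume "x \<in> (\<Union>n. A n)"
    then obtain n f where "(x, f) \<in> F n" using F by blast
    moreover have "1 \<le> \<bar>real n - real m\<bar> \<or> m = n" for m by linarith
    ultimately have "(x, case_nat (real n) f) \<in> G"
      unfolding G_def by auto
    then show "\<exists>f. (x, f) \<in> G" by blast
  next
    assume "\<exists>f. (x, f) \<in> G"
    then obtain f where f: "(x, f) \<in> G" by blast
    then obtain n where "f 0 = real n" unfolding G_def by (auto elim: Nats_cases)
    with f have "(x, \<lambda>k. f (Suc k)) \<in> F n" unfolding G_def by force
    then show "x \<in> (\<Union>n. A n)" using F by blast
  qed
  ultimately show ?thesis unfolding analytic_set_iff by blast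
qed

lemma analytic_set_INT:
  fixes A :: "nat \<Rightarrow> 'a::topological_space set"
  assumes "\<And>n. analytic_set (A n)"
  shows "analytic_set (\<Inter>n. A n)"
proof -
  obtain F :: "nat \<Rightarrow> ('a \<times> (nat \<Rightarrow> real)) set" where
    F: "\<And>n. closed (F n)" "\<And>n x. x \<in> A n \<longleftrightarrow> (\<exists>f. (x, f) \<in> F n)"
    using assms unfolding analytic_set_iff by metis
  \<comment> \<open>One sequence carries a witness for every \<open>n\<close>, interleaved by the
    pairing function.\<close>
  define G where "G = (\<Inter>n. (\<lambda>xf. (fst xf, \<lambda>k. snd xf (prod_encode (n, k)))) -` F n)"
  have coord: "continuous_on UNIV (\<lambda>xf :: 'a \<times> (nat \<Rightarrow> real). snd xf k)" for k
    by (rule continuous_on_compose2[OF continuous_on_product_coordinates]) (auto intro: continuous_intros)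
  have "closed G"
    unfolding G_def
    by (intro closed_INT ballI closed_vimage F
        continuous_intros continuous_on_coordinatewise_then_product coord)
  moreover have "x \<in> (\<Inter>n. A n) \<longleftrightarrow> (\<exists>f. (x, f) \<in> G)" for x
  proof
    assume "x \<in> (\<Inter>n. A n)"
    then obtain f where "\<And>n. (x, f n) \<in> F n" using F by (metis INT_iff UNIV_I)
    then have "(x, \<lambda>m. case_prod f (prod_decode m)) \<in> G"
      by (simp add: G_def)
    then show "\<exists>f. (x, f) \<in> G" by blast
  next
    assume "\<exists>f. (x, f) \<in> G"
    then show "x \<in> (\<Inter>n. A n)" unfolding G_def using F by auto
  qed
  ultimately show ?thesis unfolding analytic_set_iff by blast
qed

text \<open>Open subsets of a metric space are countable unions of closed sets.\<close>

lemma open_imp_analytic_set: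
  fixes A :: "'a::metric_space set"
  assumes "open A"
  shows "analytic_set A"
proof -
  obtain C where "\<And>n::nat. closedin euclidean (C n)" "\<Union> (range C) = A"
    using open_imp_fsigma_in[of euclidean A] assms metrizable_space_euclidean
    unfolding fsigma_in_ascending by auto
  then show ?thesis using analytic_set_UN[of C] closed_imp_analytic_set by auto
qed

lemma borel_imp_analytic_set:
  fixes A :: "'a::metric_space set"
  assumes "A \<in> sets borel"
  shows "analytic_set A"
proof -
  have "A \<in> sigma_sets UNIV {S. open S}" using assms by (simp add: sets_borel)
  \<comment> \<open>Analyticity alone does not pass to complements, so the induction carries both a
    set and its complement.\<close>
  then have "analytic_set A \<and> analytic_set (- A)"
  proof induction
    case (Basic a)
    then show ?case
      by (simp add: open_imp_analytic_set closed_imp_analytic_set closed_Compl)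
  next
    case (Union a)
    then show ?case
      by (simp add: analytic_set_UN analytic_set_INT Compl_UN)
  qed (auto simp: Compl_eq_Diff_UNIV[symmetric] closed_imp_analytic_set)
  then show ?thesis ..
qed

text \<open>The set is a projection of a closed set, so it receives an injection from Cantor space,
  which in turn bounds the size of the whole space.\<close>

lemma uncountable_borel_card:
  fixes A :: "'a::{complete_space, second_countable_topology} set"
  assumes "A \<in> sets borel" "uncountable A"
  shows "|UNIV :: 'a set| \<le>o |A|"
proof -
  obtain F :: "('a \<times> (nat \<Rightarrow> real)) set" where F: "closed F" "A = fst ` F"
    using borel_imp_analytic_set[OF assms(1)] unfolding analytic_set_def by blast
  obtain g :: "(nat \<Rightarrow> bool) \<Rightarrow> 'a" where "inj g" "range g \<subseteq> A"
  proof (rule inj_Cantor_into_image[OF F(1)])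
    show "continuous_on UNIV (fst :: 'a \<times> (nat \<Rightarrow> real) \<Rightarrow> 'a)"
      by (intro continuous_intros)
    show "uncountable (fst ` F)" using assms(2) F(2) by simp
  qed (use F(2) in simp)
  then have "|UNIV :: (nat \<Rightarrow> bool) set| \<le>o |A|" using card_of_ordLeq by blast
  with card_of_second_countable_le show ?thesis by (rule ordLeq_transitive)
qed

section \<open>Non-Borel sets of small cardinality\<close>

text \<open>The sections of \<open>{(u, x, f). \<forall>n. u n \<noteq> 0 \<longrightarrow> (x, f) \<notin> b n}\<close>, where \<open>b\<close> enumerates
  a base, are exactly the closed sets; the witness is the complement of the diagonal of its
  projection, which is universal for analytic sets.\<close>

lemma ex_non_borel: "\<exists>A :: (nat \<Rightarrow> real) set. A \<notin> sets borel"
proof -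
  obtain b :: "nat \<Rightarrow> ((nat \<Rightarrow> real) \<times> (nat \<Rightarrow> real)) set" where b: "topological_basis (range b)"
    using ex_basis_sequence by blast
  define D where "D = {x :: nat \<Rightarrow> real. \<forall>f. \<exists>n. x n \<noteq> 0 \<and> (x, f) \<in> b n}"
  have "\<not> analytic_set D"
  proof
    assume "analytic_set D"
    then obtain F where F: "closed F" "\<And>x. x \<in> D \<longleftrightarrow> (\<exists>f :: nat \<Rightarrow> real. (x, f) \<in> F)"
      unfolding analytic_set_iff by blast
    obtain B' where B': "B' \<subseteq> range b" "\<Union> B' = - F"
      using b F(1) unfolding topological_basis_def closed_def by meson
    \<comment> \<open>\<open>u\<close> codes the basic sets that make up the complement of
      \<open>F\<close>; membership of \<open>u\<close> in \<open>D\<close> is then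
      contradictory.\<close>
    define u :: "nat \<Rightarrow> real" where "u = (\<lambda>n. if b n \<in> B' then 1 else 0)"
    have "xf \<notin> F \<longleftrightarrow> (\<exists>n. u n \<noteq> 0 \<and> xf \<in> b n)" for xf
    proof -
      have "xf \<notin> F \<longleftrightarrow> xf \<in> \<Union> B'" unfolding B'(2) by simp
      also have "\<dots> \<longleftrightarrow> (\<exists>C\<in>B'. xf \<in> C)" by simp
      also have "\<dots> \<longleftrightarrow> (\<exists>n. b n \<in> B' \<and> xf \<in> b n)"
        using B'(1) by (metis imageE subsetD)
      finally show ?thesis by (auto simp: u_def)
    qed
    then have "u \<in> D \<longleftrightarrow> (\<forall>f. (u, f) \<notin> F)" unfolding D_def by simp
    then show False using F(2) by blast
  qed
  then show ?thesis using borel_imp_analytic_set by blast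
qed

lemma ex_non_borel_card_le:
  assumes "uncountable T"
  shows "\<exists>X :: (nat \<Rightarrow> real) set. X \<notin> sets borel \<and> |X| \<le>o |T|"
proof (cases "|UNIV :: (nat \<Rightarrow> real) set| \<le>o |T|")
  case True
  obtain A :: "(nat \<Rightarrow> real) set" where "A \<notin> sets borel" using ex_non_borel by blast
  moreover have "|A| \<le>o |T|"
    using card_of_mono1[of A UNIV] True ordLeq_transitive by blast
  ultimately show ?thesis by blast
next
  \<comment> \<open>An injective copy of \<open>T\<close> is uncountable but smaller than the whole
    space, which no Borel set can be.\<close>
  case False
  then have "|T| <o |UNIV :: (nat \<Rightarrow> real) set|"
    using not_ordLeq_iff_ordLess[OF card_of_Well_order card_of_Well_order] by blast
  then obtain f :: "_ \<Rightarrow> nat \<Rightarrow> real" where f: "inj_on f T"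
    using card_of_ordLeq[of T "UNIV :: (nat \<Rightarrow> real) set"] ordLess_imp_ordLeq by auto
  have "|f ` T| \<le>o |T|" by (rule card_of_image)
  moreover from this have "\<not> |UNIV :: (nat \<Rightarrow> real) set| \<le>o |f ` T|"
    using False ordLeq_transitive by blast
  moreover have "uncountable (f ` T)" using assms f countable_image_inj_on by blast
  ultimately show ?thesis using uncountable_borel_card by blast
qed

section \<open>Reduction to subsets of a metric space\<close>

text \<open>The image of \<open>h\<close> is the complement of the preimage of \<open>BMet Z\<close>
  under the 1-Lipschitz map \<open>G\<close>.\<close>

lemma borel_image_if_borel_BMet:
  fixes Z :: "'a topology" and h :: "'a \<Rightarrow> 'b::metric_space"
  assumes Z: "Z = discrete_topology (topspace Z)"
    and BM: "BMet Z \<in> borel_sets_of (CPM_topology Z)"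
    and fibres: "\<And>z. z \<in> topspace Z \<Longrightarrow> \<exists>z'\<in>topspace Z. z' \<noteq> z \<and> h z' = h z"
  shows "h ` topspace Z \<in> sets borel"
proof -
  define T where "T = topspace Z"
  have disc: "prod_topology Z Z = discrete_topology (T \<times> T)"
    using Z unfolding T_def by (metis prod_topology_discrete_topology)
  define g where "g = (\<lambda>x z. min 1 (dist x (h z)))"
  \<comment> \<open>The value 0 off \<open>T\<close> is forced by the encoding of
    \<open>CPM Z\<close>.\<close>
  define G where "G = (\<lambda>x z z'. if z \<in> T \<and> z' \<in> T \<and> z \<noteq> z' then max (g x z) (g x z') else 0)"
  have g0: "0 \<le> g x z" "g x z \<le> 1" for x z by (auto simp: g_def)
  have G0: "0 \<le> G x z z'" "G x z z' \<le> 1" for x z z' using g0[of x] by (auto simp: G_def le_max_iff_disj)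
  have gdist: "\<bar>g x z - g y z\<bar> \<le> dist x y" for x y z
    using dist_triangle[of x "h z" y] dist_triangle[of y "h z" x]
    unfolding g_def by (auto simp: dist_commute min_def)
  have Gdist: "\<bar>G x z z' - G y z z'\<bar> \<le> dist x y" for x y z z'
    using gdist[of x z y] gdist[of x z' y] unfolding G_def by (auto simp: max_def)
  \<comment> \<open>If \<open>v\<close> differs from \<open>u\<close> and \<open>w\<close>, the
    maximum of two nonnegative numbers is at most their sum plus further nonnegative terms;
    otherwise one summand vanishes and the other is the left side.\<close>
  have tri: "G x u w \<le> G x u v + G x v w" if "v \<in> T" for x u v w
    using that g0(1)[of x u] g0(1)[of x v] g0(1)[of x w] unfolding G_def by auto
  have Gsym: "G x z z' = G x z' z" for x z z' by (auto simp: G_def max.commute)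
  have G_eq_0: "G x z z = 0" "z \<notin> T \<or> z' \<notin> T \<Longrightarrow> G x z z' = 0" for x z z'
    by (auto simp: G_def)
  have CPM: "G x \<in> CPM Z" for x
  proof -
    have "continuous_map (prod_topology Z Z) (top_of_set {0..}) (\<lambda>(z, z'). G x z z')"
      unfolding disc using G0(1) by (auto simp: continuous_map_from_discrete_topology)
    then show ?thesis
      unfolding CPM_def T_def[symmetric] using tri Gsym G_eq_0 by blast
  qed
  have vimage_open: "open (G -` U)" if U: "openin (CPM_topology Z) U" for U
    unfolding open_dist
  proof
    fix x assume "x \<in> G -` U"
    then obtain \<epsilon> where \<epsilon>: "0 < \<epsilon>" "\<And>e. e \<in> CPM Z \<Longrightarrow> sup_dist Z (G x) e < ennreal \<epsilon> \<Longrightarrow> e \<in> U"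
      using U unfolding openin_CPM_topology by auto
    have "y \<in> G -` U" if "dist y x < \<epsilon>" for y
    proof -
      have "sup_dist Z (G x) (G y) \<le> ennreal (dist x y)"
        unfolding sup_dist_def by (rule SUP_least) (auto intro: ennreal_leI Gdist)
      also have "\<dots> < ennreal \<epsilon>"
        using that \<epsilon> by (simp add: ennreal_less_iff dist_commute)
      finally show ?thesis using \<epsilon> CPM by simp
    qed
    then show "\<exists>e>0. \<forall>y. dist y x < e \<longrightarrow> y \<in> G -` U" using \<epsilon> by blast
  qed
  have vimage_borel: "G -` A \<in> sets borel" if "A \<in> borel_sets_of (CPM_topology Z)" for A
    using that unfolding borel_sets_of_def
  proof induction
    case (Basic a)
    then show ?case using vimage_open by simp
  next
    case (Compl a)
    \<comment> \<open>All values of \<open>G\<close> lie in the topspace, so relative and absolute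
      complements have the same preimage.\<close>
    have "G -` (topspace (CPM_topology Z) - a) = - (G -` a)" using CPM by auto
    then show ?case using Compl by simp
  next
    case (Union a)
    then show ?case by (simp add: vimage_UN)
  qed simp
  have "G x \<in> BMet Z \<longleftrightarrow> x \<notin> h ` T" for x
  proof
    assume "G x \<in> BMet Z"
    then interpret Metric_space T "G x"
      unfolding BMet_def Met_def T_def by blast
    show "x \<notin> h ` T"
    proof
      assume "x \<in> h ` T"
      then obtain z where z: "z \<in> T" "x = h z" by blast
      then obtain z' where z': "z' \<in> T" "z' \<noteq> z" "h z' = h z" using fibres T_def by blast
      \<comment> \<open>Both points have \<open>h\<close>-value \<open>x\<close>, so both terms of
        the maximum vanish.\<close>
      then have "G x z z' = 0" using z by (simp add: G_def g_def)
      then show False using z z' zero by blast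
    qed
  next
    assume x: "x \<notin> h ` T"
    have pos: "0 < g x z" if "z \<in> T" for z
      using x that unfolding g_def by auto
    have lower: "g x z \<le> G x z z'" if "z \<in> T" "z' \<in> T" "z \<noteq> z'" for z z'
      using that by (simp add: G_def)
    interpret Metric_space T "G x"
    proof
      show "G x z z' = 0 \<longleftrightarrow> z = z'" if "z \<in> T" "z' \<in> T" for z z'
        using pos[OF that(1)] lower[OF that] by (cases "z = z'") (auto simp: G_def)
    qed (use tri G0(1) Gsym in blast)+
    have "mtopology = discrete_topology T"
    proof -
      \<comment> \<open>Every other point is at distance at least \<open>g x z > 0\<close> from
        \<open>z\<close>, so the open ball of that radius is a singleton.\<close>
      have "openin mtopology {z}" if "z \<in> T" for z
        unfolding openin_mtopology
        using that pos lower by (force intro!: exI[of _ "g x z"] simp: in_mball not_less[symmetric])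
      then show ?thesis by (intro discrete_topology_unique[THEN iffD2, symmetric]) auto
    qed
    then have "mtopology = Z" using Z T_def by simp
    then have "G x \<in> Met Z"
      unfolding Met_def using CPM Metric_space_axioms by (simp add: T_def)
    then show "G x \<in> BMet Z"
      unfolding BMet_def using G0(2)[of x] by blast
  qed
  then have "h ` T = - (G -` BMet Z)" by auto
  then show ?thesis using vimage_borel[OF BM] T_def by simp
qed

text \<open>An infinite \<open>T\<close> is equinumerous with two copies of itself. Applying a
  surjection onto \<open>X\<close> after forgetting the copy gives each point a twin, obtained by
  flipping the boolean.\<close>

lemma ex_map_onto_fibres_ge_2:
  assumes T: "infinite T" and X: "X \<noteq> {}" "|X| \<le>o |T|"
  shows "\<exists>h. h ` T = X \<and> (\<forall>z\<in>T. \<exists>z'\<in>T. z' \<noteq> z \<and> h z' = h z)"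
proof -
  have "|T \<times> (UNIV :: bool set)| =o |T|"
    using T finite_ordLess_infinite[OF card_of_Well_order card_of_Well_order, of "UNIV :: bool set" T]
    by (intro card_of_Times_infinite_simps) (auto intro: ordLess_imp_ordLeq simp: Field_card_of)
  then obtain j :: "_ \<Rightarrow> _ \<times> bool" where j: "bij_betw j T (T \<times> UNIV)"
    using card_of_ordIso ordIso_symmetric by blast
  obtain f where f: "f ` T = X"
    using card_of_ordLeq2[OF X(1), of T] X(2) by auto
  have jT: "j ` T = T \<times> UNIV" using j by (auto simp: bij_betw_def)
  have "(\<lambda>z. f (fst (j z))) ` T = f ` fst ` j ` T" by (simp add: image_image)
  also have "\<dots> = X" using f unfolding jT by simp
  finally have "(\<lambda>z. f (fst (j z))) ` T = X" .
  moreover have "\<exists>z'\<in>T. z' \<noteq> z \<and> f (fst (j z')) = f (fst (j z))" if "z \<in> T" for z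
  proof -
    have "j z \<in> T \<times> UNIV" using that jT by blast
    then have "(fst (j z), \<not> snd (j z)) \<in> j ` T" unfolding jT by auto
    then obtain z' where z': "z' \<in> T" "j z' = (fst (j z), \<not> snd (j z))" by auto
    then have "snd (j z') \<noteq> snd (j z)" by simp
    then have "z' \<noteq> z" by blast
    then show ?thesis using z' by (intro bexI[of _ z']) auto
  qed
  ultimately show ?thesis by blast
qed

theorem theorem3p3:
  fixes Z :: "'a topology"
  assumes "Z = discrete_topology (topspace Z)"
    and "|topspace Z| =o cardSuc natLeq"
  shows "BMet Z \<notin> borel_sets_of (CPM_topology Z)"
proof
  assume BM: "BMet Z \<in> borel_sets_of (CPM_topology Z)"
  \<comment> \<open>\<open>cardSuc natLeq\<close> is \<open>\<aleph>\<^sub>1\<close>, which lies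
    strictly above the countable cardinal \<open>natLeq\<close>.\<close>
  have "natLeq <o |topspace Z|"
    using cardSuc_greater[OF natLeq_Card_order] ordIso_symmetric[OF assms(2)]
    by (rule ordLess_ordIso_trans)
  then have unc: "uncountable (topspace Z)"
    unfolding countable_def
    by (metis card_of_nat card_of_ordLeq not_ordLess_ordLeq ordLeq_ordIso_trans subset_UNIV)
  then obtain X :: "(nat \<Rightarrow> real) set" where X: "X \<notin> sets borel" "|X| \<le>o |topspace Z|"
    using ex_non_borel_card_le by blast
  \<comment> \<open>The empty set is Borel; nonemptiness is what allows a surjection from
    \<open>topspace Z\<close> onto \<open>X\<close>.\<close>
  moreover have "X \<noteq> {}" using X(1) by auto
  moreover have "infinite (topspace Z)" using unc countable_finite by blast
  ultimately obtain h where "h ` topspace Z = X"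
    "\<And>z. z \<in> topspace Z \<Longrightarrow> \<exists>z'\<in>topspace Z. z' \<noteq> z \<and> h z' = h z"
    using ex_map_onto_fibres_ge_2[of "topspace Z" X] by metis
  then show False using borel_image_if_borel_BMet[OF assms(1) BM] X(1) by metis
qed

end
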